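(* Let $a>0$, let $n\in\mathbb{N}$, let $\Lambda\subseteq\mathbb{R}$ be a lattice and let $\Theta=\{e^{2\pi i k/n}:k=0,\dots,n-1\}$. Then the exponential system $E(\Lambda)$ does $\Theta$-PR in $L^2[0,a]$ if and only if $D(\Lambda)\ge na$.
   Context: $\mathbb{T}=\{z\in\mathbb{C}:|z|=1\}$, $\mathbb{N}=\{1,2,3,\dots\}$. $L^2[0,a]$ is the Hilbert space of complex-valued square-integrable functions on $[0,a]$ with $\langle f,g\rangle=\int_0^a f(t)\overline{g(t)}\,dt$. A lattice in $\mathbb{R}$ is a set $\Lambda=\alpha\mathbb{Z}$ with $\alpha>0$; its density is $D(\Lambda)=\lim_{r\to\infty}\frac{|\Lambda\cap[-r,r]|}{2r}=\frac1\alpha$. For $\lambda\in\mathbb{C}$ let $e_\lambda(x)=e^{2\pi i\lambda x}$, and $E(\Lambda)=\{e_\lambda\}_{\lambda\in\Lambda}$. For a Hilbert space $H$ and $\Theta\subseteq\mathbb{T}$, a set $\mathbf{G}\subseteq H$ does $\Theta$-PR in $H$ if for all $f,h\in H$ the following holds: if for every $g\in\mathbf{G}$ there exists $\theta_g\in\Theta$ with $\langle f,g\rangle=\theta_g\langle h,g\rangle$, then $f=\theta h$ for some $\theta\in\Theta$. *)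

theory Defs
  imports "HOL-Analysis.Analysis" "HOL-Real_Asymp.Real_Asymp"
begin

section \<open>The Hilbert space of square-integrable functions modulo a.e. equality\<close>

definition L2_fun :: "'a measure \<Rightarrow> ('a \<Rightarrow> complex) set" where
  "L2_fun M = {f \<in> borel_measurable M. integrable M (\<lambda>x. (cmod (f x))\<^sup>2)}"

definition L2_rel :: "'a measure \<Rightarrow> (('a \<Rightarrow> complex) \<times> ('a \<Rightarrow> complex)) set" where
  "L2_rel M = {(f, g). f \<in> L2_fun M \<and> g \<in> L2_fun M \<and> (AE x in M. f x = g x)}"

abbreviation L2_class :: "'a measure \<Rightarrow> ('a \<Rightarrow> complex) \<Rightarrow> ('a \<Rightarrow> complex) set" where
  "L2_class M f \<equiv> L2_rel M `` {f}"

definition L2 :: "'a measure \<Rightarrow> ('a \<Rightarrow> complex) set set" where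
  "L2 M = L2_fun M // L2_rel M"

text \<open>On the classes, the inner product and the scalar multiplication are defined through arbitrary
  representatives; see \<open>L2_inner_class\<close> and \<open>L2_scale_class\<close> for independence of the choice.\<close>

definition L2_inner ::
    "'a measure \<Rightarrow> ('a \<Rightarrow> complex) set \<Rightarrow> ('a \<Rightarrow> complex) set \<Rightarrow> complex" where
  "L2_inner M F G = the_elem (\<Union>f\<in>F. \<Union>g\<in>G. {LINT x|M. f x * cnj (g x)})"

definition L2_scale :: "'a measure \<Rightarrow> complex \<Rightarrow> ('a \<Rightarrow> complex) set \<Rightarrow> ('a \<Rightarrow> complex) set" where
  "L2_scale M c F = (\<Union>f\<in>F. L2_class M (\<lambda>x. c * f x))"

lemma equiv_L2_rel: "equiv (L2_fun M) (L2_rel M)"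
  unfolding L2_rel_def by (auto simp: equiv_def refl_on_def sym_def trans_def elim: AE_mp)

lemma L2_class_in_L2: "f \<in> L2_fun M \<Longrightarrow> L2_class M f \<in> L2 M"
  unfolding L2_def by (rule quotientI)

lemma L2_class_eq_iff:
  assumes "f \<in> L2_fun M" "g \<in> L2_fun M"
  shows "L2_class M f = L2_class M g \<longleftrightarrow> (AE x in M. f x = g x)"
  using eq_equiv_class_iff[OF equiv_L2_rel assms] assms by (auto simp: L2_rel_def)

lemma borel_measurable_cnj:
  "f \<in> borel_measurable M \<Longrightarrow> (\<lambda>x. cnj (f x)) \<in> borel_measurable M"
  by (rule borel_measurable_continuous_on[where f = cnj]) (intro continuous_intros)

lemma L2_inner_class:
  assumes "f \<in> L2_fun M" "g \<in> L2_fun M"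
  shows "L2_inner M (L2_class M f) (L2_class M g) = (LINT x|M. f x * cnj (g x))"
proof -
  have "(LINT x|M. f' x * cnj (g' x)) = (LINT x|M. f x * cnj (g x))"
    if "(f, f') \<in> L2_rel M" "(g, g') \<in> L2_rel M" for f' g'
  proof (rule integral_cong_AE)
    show "AE x in M. f' x * cnj (g' x) = f x * cnj (g x)"
      using that unfolding L2_rel_def by auto
  qed (use that assms in \<open>auto simp: L2_rel_def L2_fun_def
           intro!: borel_measurable_times borel_measurable_cnj\<close>)
  moreover have "(f, f) \<in> L2_rel M" "(g, g) \<in> L2_rel M"
    using assms by (auto simp: L2_rel_def)
  ultimately have "(\<Union>f'\<in>L2_class M f. \<Union>g'\<in>L2_class M g. {LINT x|M. f' x * cnj (g' x)})
      = {LINT x|M. f x * cnj (g x)}"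
    by blast
  then show ?thesis by (simp add: L2_inner_def)
qed

lemma L2_fun_scale: "f \<in> L2_fun M \<Longrightarrow> (\<lambda>x. c * f x) \<in> L2_fun M"
  by (auto simp: L2_fun_def norm_mult power_mult_distrib)

lemma L2_scale_class:
  assumes "f \<in> L2_fun M"
  shows "L2_scale M c (L2_class M f) = L2_class M (\<lambda>x. c * f x)"
proof -
  have "L2_class M (\<lambda>x. c * f' x) = L2_class M (\<lambda>x. c * f x)" if "(f, f') \<in> L2_rel M" for f'
  proof -
    have f': "f' \<in> L2_fun M" "AE x in M. f x = f' x"
      using that by (auto simp: L2_rel_def)
    from f'(2) have "AE x in M. c * f' x = c * f x"
      by eventually_elim simp
    then show ?thesis
      using assms f'(1) by (simp only: L2_class_eq_iff L2_fun_scale)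
  qed
  moreover have "(f, f) \<in> L2_rel M"
    using assms by (auto simp: L2_rel_def)
  ultimately show ?thesis unfolding L2_scale_def by blast
qed

section \<open>Phase retrieval up to a set of phases\<close>

text \<open>\<open>\<G>\<close> does \<open>\<Theta>\<close>-PR in the Hilbert space with carrier \<open>H\<close>, scalar multiplication \<open>scl\<close> and
  inner product \<open>ip\<close> (linear in the first argument).\<close>

definition does_PR ::
    "'h set \<Rightarrow> (complex \<Rightarrow> 'h \<Rightarrow> 'h) \<Rightarrow> ('h \<Rightarrow> 'h \<Rightarrow> complex) \<Rightarrow> complex set \<Rightarrow> 'h set \<Rightarrow> bool" where
  "does_PR H scl ip \<Theta> \<G> \<longleftrightarrow>
     (\<forall>f\<in>H. \<forall>h\<in>H. (\<forall>g\<in>\<G>. \<exists>\<theta>\<in>\<Theta>. ip f g = \<theta> * ip h g) \<longrightarrow> (\<exists>\<theta>\<in>\<Theta>. f = scl \<theta> h))"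

definition does_PR_L2 :: "'a measure \<Rightarrow> complex set \<Rightarrow> ('a \<Rightarrow> complex) set set \<Rightarrow> bool" where
  "does_PR_L2 M = does_PR (L2 M) (L2_scale M) (L2_inner M)"

section \<open>Lattices and exponential systems\<close>

definition is_lattice :: "real set \<Rightarrow> bool" where
  "is_lattice \<Lambda> \<longleftrightarrow> (\<exists>\<alpha>>0. \<Lambda> = range (\<lambda>k::int. \<alpha> * of_int k))"

definition lattice_density :: "real set \<Rightarrow> real" where
  "lattice_density \<Lambda> = Lim at_top (\<lambda>r::real. real (card (\<Lambda> \<inter> {-r..r})) / (2 * r))"

lemma lattice_density_eq:
  assumes "\<alpha> > 0"
  shows "lattice_density (range (\<lambda>k::int. \<alpha> * of_int k)) = 1 / \<alpha>"
proof -
  let ?L = "range (\<lambda>k::int. \<alpha> * of_int k)"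
  have card: "real (card (?L \<inter> {-r..r})) = 2 * of_int \<lfloor>r / \<alpha>\<rfloor> + 1" if "r > 0" for r :: real
  proof -
    have "?L \<inter> {-r..r} = (\<lambda>k::int. \<alpha> * of_int k) ` {-\<lfloor>r / \<alpha>\<rfloor>..\<lfloor>r / \<alpha>\<rfloor>}"
    proof -
      have "\<alpha> * of_int k \<in> {-r..r} \<longleftrightarrow> k \<in> {-\<lfloor>r / \<alpha>\<rfloor>..\<lfloor>r / \<alpha>\<rfloor>}" for k :: int
      proof -
        have "\<alpha> * of_int k \<le> r \<longleftrightarrow> k \<le> \<lfloor>r / \<alpha>\<rfloor>"
          using assms by (simp add: le_floor_iff pos_le_divide_eq mult.commute)
        moreover have "- r \<le> \<alpha> * of_int k \<longleftrightarrow> -k \<le> \<lfloor>r / \<alpha>\<rfloor>"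
          using assms by (auto simp add: le_floor_iff pos_le_divide_eq mult.commute)
        ultimately show ?thesis by auto
      qed
      then show ?thesis by blast
    qed
    moreover have "inj (\<lambda>k::int. \<alpha> * of_int k)"
      using assms by (auto simp: inj_on_def)
    ultimately have "card (?L \<inter> {-r..r}) = card {-\<lfloor>r / \<alpha>\<rfloor>..\<lfloor>r / \<alpha>\<rfloor>}"
      by (metis card_image inj_on_subset subset_UNIV)
    then show ?thesis using assms that by simp
  qed
  have "((\<lambda>r::real. (2 * of_int \<lfloor>r / \<alpha>\<rfloor> + 1) / (2 * r)) \<longlongrightarrow> 1 / \<alpha>) at_top"
    using assms by (real_asymp simp: field_simps)
  then have "((\<lambda>r::real. real (card (?L \<inter> {-r..r})) / (2 * r)) \<longlongrightarrow> 1 / \<alpha>) at_top"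
    by (rule Lim_transform_eventually)
       (rule eventually_mono[OF eventually_gt_at_top[of 0]], simp only: card)
  then show ?thesis
    unfolding lattice_density_def by (intro tendsto_Lim) auto
qed

definition exponential :: "complex \<Rightarrow> real \<Rightarrow> complex" where
  "exponential \<nu> x = exp (2 * of_real pi * \<i> * \<nu> * of_real x)"

definition exp_system :: "real set \<Rightarrow> (real \<Rightarrow> complex) set" where
  "exp_system \<Lambda> = (\<lambda>\<nu>. exponential (of_real \<nu>)) ` \<Lambda>"

lemma exponential_in_L2_fun: "exponential \<nu> \<in> L2_fun (lebesgue_on {0..a})"
proof -
  have "continuous_on {0..a} (exponential \<nu>)"
    unfolding exponential_def by (intro continuous_intros)
  moreover from this have "continuous_on {0..a} (\<lambda>x. (cmod (exponential \<nu> x))\<^sup>2)"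
    by (intro continuous_intros)
  ultimately show ?thesis
    unfolding L2_fun_def
    by (auto intro: continuous_imp_measurable_on_sets_lebesgue continuous_imp_integrable_real)
qed

end

(*
  Write F f w for the integral of f t * exp (w * t) over [0,a], an entire function of w whose values
  on the imaginary lattice are the inner products of f with the exponentials.

  If n * a * alpha <= 1 and the data of f and h agree up to n-th roots of unity, then
  G = (F f)^n - (F h)^n vanishes on the zeros of exp (w / alpha) - 1, all of which are simple, and it
  grows no faster than that function away from them. The quotient is thus entire and, by the maximum
  modulus principle on rectangles around the zeros, bounded, hence constant. Letting w tend to
  -infinity along the reals shows that the constant is 0. From (F f)^n = (F h)^n, finitely many zero
  sets of entire functions F f - theta * F h cover the plane, so one of them is uncountable and
  F f = theta * F h; comparing Taylor coefficients, all moments of f - theta * h vanish.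

  If n * a * alpha > 1, then s = 1 / (n * alpha) < a, and translating the indicator of [0, a - s] by
  s multiplies its inner product with the exponential of frequency alpha * k by an n-th root of
  unity.
*)
theory Submission
  imports Defs "HOL-Complex_Analysis.Complex_Analysis"
begin

section \<open>Entire functions vanishing on a lattice\<close>

text \<open>At a zero of \<open>D\<close> the derivative of \<open>D\<close> does not vanish, so
  dividing both functions by \<open>w - z\<close> shows that \<open>G w / D w\<close> has a finite
  limit there and the singularity is removable. The point \<open>z0\<close> rules out
  \<open>D\<close> being identically zero, which makes the zeros of \<open>D\<close>
  isolated.\<close>

lemma holomorphic_quotient_simple_zeros:
  fixes G D :: "complex \<Rightarrow> complex"
  assumes G: "G holomorphic_on UNIV" and D: "D holomorphic_on UNIV"
    and zeros: "\<And>z. D z = 0 \<Longrightarrow> G z = 0 \<and> deriv D z \<noteq> 0"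
    and nz: "D z0 \<noteq> 0"
  obtains Q where "Q holomorphic_on UNIV" "\<And>z. G z = Q z * D z"
proof -
  \<comment> \<open>At a zero of \<open>D\<close> the value is the limit that l'Hopital's rule
    predicts, so \<open>Q\<close> needs no later correction.\<close>
  define Q where "Q z = (if D z = 0 then deriv G z / deriv D z else G z / D z)" for z
  have "Q analytic_on {z}" for z
  proof -
    obtain r where r: "r > 0" "\<And>w. w \<in> ball z r - {z} \<Longrightarrow> D w \<noteq> 0"
    proof (cases "D z = 0")
      case True
      then show ?thesis
        using isolated_zeros[OF D open_UNIV connected_UNIV, of z z0] nz that by auto
    next
      case False
      have "continuous_on UNIV D"
        using D by (rule holomorphic_on_imp_continuous_on)
      then show ?thesis
        using continuous_on_open_avoid[of UNIV D z 0] False that by (auto simp: dist_commute)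
    qed
    have "Q holomorphic_on ball z r"
    \<comment> \<open>Off the centre, \<open>Q\<close> is a quotient with nonvanishing denominator
      on this ball; continuity at the centre is then enough for holomorphy on the whole
      ball.\<close>
    proof (rule no_isolated_singularity'[where K = "{z}"])
      have "(\<lambda>w. G w / D w) holomorphic_on ball z r - {z}"
        using r by (intro holomorphic_intros holomorphic_on_subset[OF G] holomorphic_on_subset[OF D]) auto
      then show "Q holomorphic_on ball z r - {z}"
        by (rule holomorphic_transform) (use r in \<open>auto simp: Q_def\<close>)
      fix u assume "u \<in> {z}"
      moreover have "(Q \<longlongrightarrow> Q z) (at z)"
      proof (cases "D z = 0")
        case True
        have dG: "((\<lambda>w. G w / (w - z)) \<longlongrightarrow> deriv G z) (at z)"
          using holomorphic_derivI[OF G open_UNIV, of z] zeros[OF True]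
          by (simp add: has_field_derivative_iff)
        have dD: "((\<lambda>w. D w / (w - z)) \<longlongrightarrow> deriv D z) (at z)"
          using holomorphic_derivI[OF D open_UNIV, of z] True
          by (simp add: has_field_derivative_iff)
        have "((\<lambda>w. (G w / (w - z)) / (D w / (w - z))) \<longlongrightarrow> deriv G z / deriv D z) (at z)"
          using zeros[OF True] by (intro tendsto_divide dG dD) auto
        moreover have "\<forall>\<^sub>F w in at z. w \<in> ball z r"
          using r by (intro eventually_at_in_open') auto
        then have "\<forall>\<^sub>F w in at z. (G w / (w - z)) / (D w / (w - z)) = Q w"
          using eventually_neq_at_within[of z z UNIV] by eventually_elim (use r(2) in \<open>auto simp: Q_def\<close>)
        ultimately show ?thesis
          using True by (auto simp: Q_def intro: Lim_transform_eventually)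
      next
        case False
        have "((\<lambda>w. G w / D w) \<longlongrightarrow> G z / D z) (at z)"
          using holomorphic_on_imp_continuous_on[OF G] holomorphic_on_imp_continuous_on[OF D] False
          by (intro tendsto_divide) (auto simp: continuous_on_def)
        moreover have "\<forall>\<^sub>F w in at z. w \<in> ball z r"
          using r by (intro eventually_at_in_open') auto
        then have "\<forall>\<^sub>F w in at z. G w / D w = Q w"
          using eventually_neq_at_within[of z z UNIV] by eventually_elim (use r(2) in \<open>auto simp: Q_def\<close>)
        ultimately show ?thesis
          using False by (auto simp: Q_def intro: Lim_transform_eventually)
      qed
      ultimately show "(Q \<longlongrightarrow> Q u) (at u within ball z r)"
        using tendsto_within_subset by blast
    qed auto
    then show ?thesis
      using r(1) unfolding analytic_at by (metis centre_in_ball open_ball)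
  qed
  then have "Q holomorphic_on UNIV"
    using analytic_on_analytic_at analytic_imp_holomorphic by blast
  moreover have "G z = Q z * D z" for z
    using zeros[of z] by (auto simp: Q_def)
  ultimately show ?thesis using that by blast
qed

text \<open>The given zeros are exactly those of \<open>exp w - 1\<close>, and the bound is the
  growth of that function. Its constant multiples satisfy all assumptions but \<open>lim\<close>;
  the limit along the negative reals forces the constant to be 0.\<close>

lemma entire_eq_zero_if_zero_on_periods:
  fixes G :: "complex \<Rightarrow> complex"
  assumes G: "G holomorphic_on UNIV"
    and bound: "\<And>w. norm (G w) \<le> C * max 1 (exp (Re w))"
    and zero: "\<And>k::int. G (of_int k * (2 * of_real pi * \<i>)) = 0"
    and lim: "((\<lambda>x::real. G (of_real (- x))) \<longlongrightarrow> 0) at_top"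
  shows "G w = 0"
proof -
  define D :: "complex \<Rightarrow> complex" where "D w = exp w - 1" for w
  have D: "D holomorphic_on UNIV"
    unfolding D_def by (intro holomorphic_intros)
  have deriv_D: "deriv D z = exp z" for z
    unfolding D_def by (rule DERIV_imp_deriv) (auto intro!: derivative_eq_intros)
  have "G z = 0" if "D z = 0" for z
  proof -
    from that obtain k :: int where "Re z = 0" "Im z = of_int (2 * k) * pi"
      by (auto simp: D_def exp_eq_1)
    then have "z = of_int k * (2 * of_real pi * \<i>)"
      by (simp add: complex_eq_iff)
    then show ?thesis using zero by simp
  qed
  moreover have D1: "D 1 \<noteq> 0"
    using exp_of_real[of 1, where 'a = complex] by (auto simp: D_def simp flip: of_real_exp)
  ultimately obtain Q where Q: "Q holomorphic_on UNIV" and GQ: "\<And>z. G z = Q z * D z"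
    using holomorphic_quotient_simple_zeros[OF G D, of 1] D1
    by (metis deriv_D exp_not_eq_zero)
  have "C \<ge> 0"
    using order_trans[OF norm_ge_zero bound[of 0]] by simp
  \<comment> \<open>Bounding \<open>Q\<close> is reduced to a lower bound for \<open>D\<close> by
    its own growth, up to a factor 2. The estimates that follow treat two half planes and certain
    horizontal lines, which together contain the boundary of every rectangle used below.\<close>
  have Q_bound: "norm (Q z) \<le> 2 * C" if "max 1 (exp (Re z)) \<le> 2 * norm (D z)" for z
  proof -
    have "norm (Q z) * norm (D z) \<le> C * max 1 (exp (Re z))"
      using bound[of z] by (simp add: GQ norm_mult)
    also have "\<dots> \<le> C * (2 * norm (D z))"
      using that \<open>C \<ge> 0\<close> by (intro mult_left_mono)
    finally have "norm (Q z) * norm (D z) \<le> (2 * C) * norm (D z)" by simp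
    moreover have "norm (D z) > 0" using that by linarith
    ultimately show ?thesis by simp
  qed
  have e2: "exp (1::real) \<ge> 2"
    using exp_ge_add_one_self[of 1] by simp
  have D_right: "max 1 (exp (Re z)) \<le> 2 * norm (D z)" if "Re z \<ge> 1" for z
  proof -
    have "exp (Re z) \<ge> 2" using e2 that exp_le_cancel_iff order_trans by blast
    moreover have "norm (D z) \<ge> exp (Re z) - 1"
      using norm_triangle_ineq2[of "exp z" 1] by (simp add: D_def)
    ultimately show ?thesis by simp
  qed
  have D_left: "max 1 (exp (Re z)) \<le> 2 * norm (D z)" if "Re z \<le> -1" for z
  proof -
    have "exp (Re z) \<le> exp (-1)" using that by simp
    also have "exp (-1::real) \<le> 1/2" using e2 by (simp add: exp_minus field_simps)
    finally have "exp (Re z) \<le> 1 / 2" .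
    moreover have "norm (D z) \<ge> 1 - exp (Re z)"
      using norm_triangle_ineq2[of 1 "exp z"] by (simp add: D_def norm_minus_commute)
    ultimately show ?thesis by simp
  qed
  \<comment> \<open>Here \<open>exp z\<close> is a negative real number, so no cancellation occurs
    in \<open>exp z - 1\<close>.\<close>
  have D_line: "max 1 (exp (Re z)) \<le> 2 * norm (D z)" if "exp (\<i> * of_real (Im z)) = -1" for z
  proof -
    have "exp z = exp (of_real (Re z)) * exp (\<i> * of_real (Im z))"
      by (metis complex_eq exp_add)
    then have "D z = - of_real (exp (Re z) + 1)"
      using that by (simp add: D_def exp_of_real)
    then have "norm (D z) = exp (Re z) + 1"
      by (metis abs_of_pos add_pos_pos exp_gt_zero norm_minus_cancel norm_of_real zero_less_one)
    then show ?thesis by simp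
  qed
  have "norm (Q z) \<le> 2 * C" for z
  proof (cases "\<bar>Re z\<bar> \<ge> 1")
    case True
    then have "Re z \<le> -1 \<or> Re z \<ge> 1" by linarith
    then show ?thesis using D_left D_right Q_bound by blast
  next
    case False
    \<comment> \<open>This choice puts \<open>Im z\<close> between the consecutive odd multiples
      \<open>(2 * m + 1) * pi\<close> and \<open>(2 * m + 3) * pi\<close>. The zeros of
      \<open>D\<close> have even multiples of \<open>pi\<close> as imaginary parts, so the
      horizontal edges run midway between zeros.\<close>
    define m :: int where "m = \<lfloor>(Im z / pi - 1) / 2\<rfloor>"
    have m: "of_int m \<le> (Im z / pi - 1) / 2" "(Im z / pi - 1) / 2 \<le> of_int m + 1"
      unfolding m_def by linarith+
    let ?l = "(2 * of_int m + 1) * pi" and ?u = "(2 * of_int m + 3) * pi"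
    let ?R = "cbox (Complex (-1) ?l) (Complex 1 ?u)"
    have edge: "exp (\<i> * of_real ?l) = -1" "exp (\<i> * of_real ?u) = -1"
    proof -
      have "exp (\<i> * of_real ((2 * of_int k + 1) * pi)) = -1" for k :: int
      proof -
        have "\<i> * of_real ((2 * of_int k + 1) * pi) = 2 * of_real pi * \<i> * of_int k + of_real pi * \<i>"
          by (simp add: algebra_simps)
        then show ?thesis
          using exp_integer_2pi[OF Ints_of_int[of k]] by (simp add: exp_add ac_simps)
      qed
      from this[of m] this[of "m + 1"] show "exp (\<i> * of_real ?l) = -1" "exp (\<i> * of_real ?u) = -1"
        by (simp_all add: add.assoc distrib_left)
    qed
    show ?thesis
    proof (rule maximum_modulus_frontier[where f = Q and S = ?R])
      show "Q holomorphic_on interior ?R"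
        using Q by (rule holomorphic_on_subset) simp
      show "continuous_on (closure ?R) Q"
        using holomorphic_on_imp_continuous_on[OF Q] by (rule continuous_on_subset) simp
      show "z \<in> ?R"
        using False m by (auto simp: in_cbox_complex_iff field_simps)
      fix v assume "v \<in> frontier ?R"
      then have "Re v = -1 \<or> Re v = 1 \<or> Im v = ?l \<or> Im v = ?u"
        by (auto simp: frontier_cbox in_cbox_complex_iff in_box_complex_iff)
      then show "norm (Q v) \<le> 2 * C"
        using D_left[of v] D_right[of v] D_line[of v] edge Q_bound[of v]
        by (metis order_refl)
    qed auto
  qed
  then have "Q constant_on UNIV"
    using Q by (intro Liouville_theorem) (auto simp: bounded_iff)
  then obtain c where c: "\<And>z. Q z = c"
    by (auto simp: constant_on_def)
  \<comment> \<open>\<open>exp (- x)\<close> tends to 0, so \<open>D\<close> tends to -1 and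
    \<open>G\<close> to \<open>- c\<close>; by assumption \<open>G\<close> tends to 0.\<close>
  have "((\<lambda>x::real. c * D (of_real (- x))) \<longlongrightarrow> c * (0 - 1)) at_top"
  proof -
    have "((\<lambda>x::real. exp (- x)) \<longlongrightarrow> 0) at_top"
      by (rule filterlim_compose[OF exp_at_bot filterlim_uminus_at_bot_at_top])
    then have "((\<lambda>x::real. of_real (exp (- x)) :: complex) \<longlongrightarrow> of_real 0) at_top"
      by (rule tendsto_of_real)
    then show ?thesis
      unfolding D_def by (intro tendsto_intros) (simp flip: exp_of_real)
  qed
  moreover have "((\<lambda>x::real. c * D (of_real (- x))) \<longlongrightarrow> 0) at_top"
    using lim by (simp add: GQ c)
  ultimately have "c = 0"
    using tendsto_unique[OF trivial_limit_at_top_linorder] by fastforce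
  then show ?thesis by (simp add: GQ c)
qed

text \<open>At each point the two values differ by an n-th root of unity that may vary with the
  point. Counting makes the root uniform: one of finitely many roots must work on an uncountable
  set, and a nonconstant entire function has only countably many zeros.\<close>

lemma entire_functions_proportional_if_powers_eq:
  fixes F H :: "complex \<Rightarrow> complex"
  assumes F: "F holomorphic_on UNIV" and H: "H holomorphic_on UNIV"
    and "n \<ge> 1" and eq: "\<And>w. F w ^ n = H w ^ n"
  obtains \<theta> where "\<theta> ^ n = 1" "\<And>w. F w = \<theta> * H w"
proof -
  let ?\<Theta> = "{\<theta>::complex. \<theta> ^ n = 1}"
  let ?Z = "\<lambda>\<theta>. {w. F w - \<theta> * H w = 0}"
  have "w \<in> (\<Union>\<theta>\<in>?\<Theta>. ?Z \<theta>)" for w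
  proof (cases "H w = 0")
    case True
    then have "F w = 0" using eq[of w] \<open>n \<ge> 1\<close> by (simp add: power_0_left)
    \<comment> \<open>Both values are 0, so any root serves; 1 is taken.\<close>
    then show ?thesis using True by (auto intro!: exI[of _ 1])
  next
    case False
    then have "F w / H w \<in> ?\<Theta>" using eq[of w] by (simp add: power_divide)
    then show ?thesis using False by (intro UN_I[of "F w / H w"]) auto
  qed
  then have "(\<Union>\<theta>\<in>?\<Theta>. ?Z \<theta>) = UNIV" by blast
  moreover have "uncountable (UNIV :: complex set)"
    using uncountable_ball[of 1 "0::complex"] countable_subset[of "ball 0 1" "UNIV :: complex set"] by auto
  moreover have "countable ?\<Theta>"
    using finite_roots_unity[OF \<open>n \<ge> 1\<close>] by (rule countable_finite)
  ultimately obtain \<theta> where \<theta>: "\<theta> \<in> ?\<Theta>" "uncountable (?Z \<theta>)"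
    using countable_UN[of ?\<Theta> ?Z] by metis
  have hol: "(\<lambda>w. F w - \<theta> * H w) holomorphic_on UNIV"
    using F H by (intro holomorphic_intros)
  have "(\<lambda>w. F w - \<theta> * H w) constant_on UNIV"
    using holomorphic_countable_zeros[OF hol open_UNIV connected_UNIV] \<theta>(2)
    by (auto simp: fsigma_UNIV)
  moreover have "?Z \<theta> \<noteq> {}"
    using \<theta>(2) by (metis countable_empty)
  then obtain v where "F v - \<theta> * H v = 0" by blast
  ultimately have "F w - \<theta> * H w = 0" for w
    unfolding constant_on_def by (metis UNIV_I)
  then show ?thesis using that \<theta>(1) by auto
qed

section \<open>Functions with vanishing moments\<close>

lemma integrable_mult_bounded_measurable:
  fixes f \<phi> :: "'a::euclidean_space \<Rightarrow> 'b::{real_normed_field, banach, second_countable_topology}"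
  assumes f: "integrable (lebesgue_on S) f" and \<phi>: "\<phi> \<in> borel_measurable (lebesgue_on S)"
    and bound: "\<And>t. t \<in> S \<Longrightarrow> norm (\<phi> t) \<le> B"
  shows "integrable (lebesgue_on S) (\<lambda>t. f t * \<phi> t)"
proof (rule Bochner_Integration.integrable_bound)
  show "integrable (lebesgue_on S) (\<lambda>t. B * norm (f t))" using f by simp
  show "(\<lambda>t. f t * \<phi> t) \<in> borel_measurable (lebesgue_on S)"
    using f \<phi> by (intro borel_measurable_times) auto
  show "AE t in lebesgue_on S. norm (f t * \<phi> t) \<le> norm (B * norm (f t))"
  proof (rule AE_I2)
    fix t assume "t \<in> space (lebesgue_on S)"
    then have "norm (\<phi> t) \<le> \<bar>B\<bar>" using bound[of t] by (simp add: space_restrict_space)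
    then show "norm (f t * \<phi> t) \<le> norm (B * norm (f t))"
      using mult_right_mono[of "norm (\<phi> t)" "\<bar>B\<bar>" "norm (f t)"]
      by (simp add: norm_mult abs_mult mult.commute)
  qed
qed

text \<open>By Weierstrass approximation \<open>f\<close> is orthogonal to all continuous functions.
  Since \<open>f\<close> is only integrable, it is then tested against \<open>sgn f\<close>, a
  bounded almost everywhere limit of continuous functions; this gives the integral of
  \<open>\<bar>f\<bar>\<close>.\<close>

lemma AE_eq_0_if_moments_eq_0_real:
  fixes f :: "real \<Rightarrow> real"
  assumes f: "integrable (lebesgue_on {a..b}) f"
    and moments: "\<And>k. (LINT t|lebesgue_on {a..b}. f t * t ^ k) = 0"
  shows "AE t in lebesgue_on {a..b}. f t = 0"
proof -
  let ?M = "lebesgue_on {a..b}"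
  have cont_meas: "\<phi> \<in> borel_measurable ?M" if "continuous_on {a..b} \<phi>" for \<phi> :: "real \<Rightarrow> real"
    using that by (intro continuous_imp_measurable_on_sets_lebesgue) auto
  have int_cont: "integrable ?M (\<lambda>t. f t * \<phi> t)" if \<phi>: "continuous_on {a..b} \<phi>" for \<phi>
  proof -
    obtain B where B: "\<forall>x \<in> \<phi> ` {a..b}. norm x \<le> B"
      using compact_imp_bounded[OF compact_continuous_image[OF \<phi> compact_Icc]]
      unfolding bounded_iff by blast
    show ?thesis
      using f cont_meas[OF \<phi>] by (rule integrable_mult_bounded_measurable) (use B in blast)
  qed
  have continuous: "(LINT t|?M. f t * \<phi> t) = 0" if \<phi>: "continuous_on {a..b} \<phi>" for \<phi>
  proof -
    \<comment> \<open>A polynomial uniformly within \<open>e\<close> of \<open>\<phi>\<close>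
      integrates to 0 against \<open>f\<close>, so only the error term remains.\<close>
    have "\<bar>LINT t|?M. f t * \<phi> t\<bar> \<le> e * (LINT t|?M. \<bar>f t\<bar>)" if "e > 0" for e
    proof -
      obtain p where p: "real_polynomial_function p" and close: "\<And>t. t \<in> {a..b} \<Longrightarrow> \<bar>\<phi> t - p t\<bar> < e"
        using Stone_Weierstrass_real_polynomial_function[OF _ \<phi> \<open>e > 0\<close>] by auto
      obtain c N where pc: "p = (\<lambda>t. \<Sum>i\<le>N. c i * t ^ i)"
        using p by (auto simp: real_polynomial_function_iff_sum)
      have cont_p: "continuous_on {a..b} p"
        unfolding pc by (intro continuous_intros)
      have "(LINT t|?M. f t * p t) = (LINT t|?M. (\<Sum>i\<le>N. c i * (f t * t ^ i)))"
        by (simp add: pc sum_distrib_left algebra_simps)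
      also have "\<dots> = (\<Sum>i\<le>N. c i * (LINT t|?M. f t * t ^ i))"
        by (subst Bochner_Integration.integral_sum)
           (auto intro!: integrable_mult_right int_cont continuous_on_power)
      finally have p0: "(LINT t|?M. f t * p t) = 0" by (simp add: moments)
      have "(LINT t|?M. f t * \<phi> t) = (LINT t|?M. f t * (\<phi> t - p t))"
        using int_cont[OF \<phi>] int_cont[OF cont_p] p0 by (simp add: right_diff_distrib)
      also have "\<bar>\<dots>\<bar> \<le> (LINT t|?M. \<bar>f t * (\<phi> t - p t)\<bar>)"
        by (rule integral_abs_bound)
      also have "\<dots> \<le> (LINT t|?M. e * \<bar>f t\<bar>)"
      proof (rule integral_mono)
        show "integrable ?M (\<lambda>t. \<bar>f t * (\<phi> t - p t)\<bar>)"
          using \<phi> cont_p by (intro integrable_abs int_cont continuous_intros)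
        fix t assume "t \<in> space ?M"
        then have "\<bar>\<phi> t - p t\<bar> \<le> e"
          using close[of t] by (simp add: space_restrict_space less_imp_le)
        then show "\<bar>f t * (\<phi> t - p t)\<bar> \<le> e * \<bar>f t\<bar>"
          using mult_right_mono[of "\<bar>\<phi> t - p t\<bar>" e "\<bar>f t\<bar>"] by (simp add: abs_mult mult.commute)
      qed (use f in simp)
      finally show ?thesis by simp
    qed
    then have lim: "\<forall>\<^sub>F e in at_right 0. \<bar>LINT t|?M. f t * \<phi> t\<bar> \<le> e * (LINT t|?M. \<bar>f t\<bar>)"
      by (auto simp: eventually_at_right_less intro: eventually_mono[OF eventually_at_right_less])
    have "((\<lambda>e. e * (LINT t|?M. \<bar>f t\<bar>)) \<longlongrightarrow> 0 * (LINT t|?M. \<bar>f t\<bar>)) (at_right 0)"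
      by (intro tendsto_intros)
    then have "\<bar>LINT t|?M. f t * \<phi> t\<bar> \<le> 0"
      using tendsto_lowerbound[OF _ lim] by fastforce
    then show ?thesis by simp
  qed
  have sgn_f: "(\<lambda>t. sgn (f t)) \<in> borel_measurable ?M"
    using f by (auto intro: borel_measurable_sgn)
  \<comment> \<open>Extension by 0 to the whole line allows the characterisation of measurability by
    almost everywhere limits of continuous functions to be applied.\<close>
  have "(\<lambda>t. if t \<in> {a..b} then sgn (f t) else 0) \<in> borel_measurable lebesgue"
    using sgn_f by (subst borel_measurable_if) auto
  then have "(\<lambda>t. if t \<in> {a..b} then sgn (f t) else 0) measurable_on UNIV"
    by (intro lebesgue_measurable_imp_measurable_on_real) auto
  then have "\<exists>N g. negligible N \<and> (\<forall>n. continuous_on UNIV (g n)) \<and>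
      (\<forall>t. t \<notin> N \<longrightarrow> (\<lambda>n. g n t) \<longlonglongrightarrow> (if t \<in> {a..b} then sgn (f t) else 0))"
    unfolding measurable_on_def by (simp only: UNIV_I if_True)
  then obtain N g where N: "negligible N" and g: "\<forall>n. continuous_on UNIV (g n)"
    and lim: "\<forall>t. t \<notin> N \<longrightarrow> (\<lambda>n. g n t) \<longlonglongrightarrow> (if t \<in> {a..b} then sgn (f t) else 0)"
    by (elim exE conjE) (rule that)
  \<comment> \<open>Clipping to [-1, 1] keeps continuity and, as \<open>sgn\<close> takes values in
    that range, the limit; it provides \<open>\<bar>f\<bar>\<close> as the dominating
    function.\<close>
  define G where "G n t = max (-1) (min 1 (g n t))" for n :: nat and t :: real
  have cont_G: "continuous_on {a..b} (G n)" for n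
    unfolding G_def by (intro continuous_intros continuous_on_subset[OF g[rule_format]]) auto
  have "(\<lambda>n. LINT t|?M. f t * G n t) \<longlonglongrightarrow> (LINT t|?M. f t * sgn (f t))"
  proof (rule integral_dominated_convergence[where w = "\<lambda>t. \<bar>f t\<bar>"])
    show "(\<lambda>t. f t * sgn (f t)) \<in> borel_measurable ?M"
      using f sgn_f by (intro borel_measurable_times) auto
    show "(\<lambda>t. f t * G n t) \<in> borel_measurable ?M" for n
      using int_cont[OF cont_G] by auto
    show "integrable ?M (\<lambda>t. \<bar>f t\<bar>)" using f by simp
    show "AE t in ?M. norm (f t * G n t) \<le> \<bar>f t\<bar>" for n
    proof (rule AE_I2)
      fix t
      have "\<bar>G n t\<bar> \<le> 1" by (auto simp: G_def)
      then show "norm (f t * G n t) \<le> \<bar>f t\<bar>"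
        using mult_left_mono[of "\<bar>G n t\<bar>" 1 "\<bar>f t\<bar>"] by (simp add: abs_mult)
    qed
    have "AE t in lebesgue. t \<notin> N"
      using N by (simp add: negligible_iff_null_sets AE_not_in)
    then have "AE t in lebesgue. t \<in> {a..b} \<longrightarrow> (\<lambda>n. f t * G n t) \<longlonglongrightarrow> f t * sgn (f t)"
    proof eventually_elim
      fix t assume "t \<notin> N"
      show "t \<in> {a..b} \<longrightarrow> (\<lambda>n. f t * G n t) \<longlonglongrightarrow> f t * sgn (f t)"
      proof
        assume "t \<in> {a..b}"
        then have "(\<lambda>n. max (-1) (min 1 (g n t))) \<longlonglongrightarrow> max (-1) (min 1 (sgn (f t)))"
          using lim[rule_format, OF \<open>t \<notin> N\<close>] by (intro tendsto_intros) auto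
        moreover have "max (-1) (min 1 (sgn (f t))) = sgn (f t)"
          by (simp add: sgn_if)
        ultimately show "(\<lambda>n. f t * G n t) \<longlonglongrightarrow> f t * sgn (f t)"
          unfolding G_def by (intro tendsto_intros) simp
      qed
    qed
    then show "AE t in ?M. (\<lambda>n. f t * G n t) \<longlonglongrightarrow> f t * sgn (f t)"
      by (simp add: AE_restrict_space_iff)
  qed
  then have "(LINT t|?M. f t * sgn (f t)) = 0"
    using continuous[OF cont_G] by (simp add: LIMSEQ_const_iff)
  then have "(LINT t|?M. \<bar>f t\<bar>) = 0"
    by (simp add: abs_sgn)
  then show ?thesis
    using f by (subst (asm) integral_nonneg_eq_0_iff_AE) auto
qed

text \<open>The powers of \<open>t\<close> are real, so the real and imaginary parts of
  \<open>f\<close> have vanishing moments separately.\<close>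

lemma AE_eq_0_if_moments_eq_0:
  fixes f :: "real \<Rightarrow> complex"
  assumes f: "integrable (lebesgue_on {a..b}) f"
    and moments: "\<And>k. (LINT t|lebesgue_on {a..b}. f t * of_real t ^ k) = 0"
  shows "AE t in lebesgue_on {a..b}. f t = 0"
proof -
  let ?M = "lebesgue_on {a..b}"
  have int: "integrable ?M (\<lambda>t. f t * of_real t ^ k)" for k
    using f
  proof (rule integrable_mult_bounded_measurable)
    show "(\<lambda>t. complex_of_real t ^ k) \<in> borel_measurable ?M"
      by (intro continuous_imp_measurable_on_sets_lebesgue continuous_intros) auto
    show "norm (complex_of_real t ^ k) \<le> (max \<bar>a\<bar> \<bar>b\<bar>) ^ k" if "t \<in> {a..b}" for t
      unfolding norm_power using that by (intro power_mono) auto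
  qed
  have "(LINT t|?M. Re (f t) * t ^ k) = 0" "(LINT t|?M. Im (f t) * t ^ k) = 0" for k
    using integral_Re[OF int[of k]] integral_Im[OF int[of k]] moments[of k]
    by (simp_all flip: of_real_power)
  then have "AE t in ?M. Re (f t) = 0" "AE t in ?M. Im (f t) = 0"
    using f by (auto intro!: AE_eq_0_if_moments_eq_0_real)
  then show ?thesis
    by eventually_elim (simp add: complex_eq_iff)
qed

section \<open>The exponential transform on an interval\<close>

text \<open>The Laplace transform of \<open>f\<close> cut off to [0, a], with the sign of the
  exponent reversed. A complex argument in place of a real frequency makes complex analysis
  available.\<close>

definition exp_transform :: "real \<Rightarrow> (real \<Rightarrow> complex) \<Rightarrow> complex \<Rightarrow> complex" where
  "exp_transform a f w = (LINT t|lebesgue_on {0..a}. f t * exp (w * of_real t))"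

text \<open>The exponent \<open>Re w * t\<close> is largest at one of the two ends of the
  interval.\<close>

lemma norm_exp_le_max:
  assumes "t \<in> {0..a}"
  shows "norm (exp (w * of_real t)) \<le> max 1 (exp (a * Re w))"
proof (cases "Re w \<ge> 0")
  case True
  then have "Re w * t \<le> a * Re w" using assms mult_right_mono[of t a "Re w"] by (simp add: mult.commute)
  then show ?thesis by (simp add: le_max_iff_disj)
next
  case False
  then have "Re w * t \<le> 0" using assms by (simp add: mult_nonpos_nonneg)
  then show ?thesis by (simp add: le_max_iff_disj)
qed

lemma measurable_exp_kernel: "(\<lambda>t. exp ((w::complex) * of_real t)) \<in> borel_measurable (lebesgue_on {0..a})"
  by (intro continuous_imp_measurable_on_sets_lebesgue continuous_intros) auto

lemma integrable_exp_kernel: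
  assumes "integrable (lebesgue_on {0..a}) f"
  shows "integrable (lebesgue_on {0..a}) (\<lambda>t. f t * exp ((w::complex) * of_real t))"
  using assms measurable_exp_kernel norm_exp_le_max by (rule integrable_mult_bounded_measurable)

text \<open>The exponential series may be integrated term by term, because the k-th term is
  dominated by \<open>norm (f t)\<close> times \<open>(a * norm w) ^ k / fact k\<close>. The
  expansion yields both holomorphy and access to the moments of \<open>f\<close>.\<close>

lemma exp_transform_sums:
  assumes f: "integrable (lebesgue_on {0..a}) f"
  shows "(\<lambda>k. (LINT t|lebesgue_on {0..a}. f t * of_real t ^ k) / fact k * w ^ k) sums exp_transform a f w"
proof -
  let ?M = "lebesgue_on {0..a}"
  let ?g = "\<lambda>k t. f t * (of_real t ^ k * w ^ k / fact k)"
  let ?r = "a * norm w"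
  have norm_le: "norm (of_real t ^ k * w ^ k / fact k) \<le> ?r ^ k / fact k" if "t \<in> {0..a}" for t k
    using that by (auto simp: norm_mult norm_divide norm_power power_mult_distrib
                        intro!: divide_right_mono mult_right_mono power_mono)
  have int: "integrable ?M (?g k)" for k
    using f _ norm_le
    by (rule integrable_mult_bounded_measurable)
       (intro continuous_imp_measurable_on_sets_lebesgue continuous_intros, auto)
  have "(\<lambda>k. integral\<^sup>L ?M (?g k)) sums (LINT t|?M. (\<Sum>k. ?g k t))"
  proof (rule sums_integral[OF int])
    have summ: "summable (\<lambda>k. x ^ k / fact k)" for x :: real
      using summable_exp[of x] by (simp add: divide_inverse mult.commute)
    have "summable (\<lambda>k. norm (?g k t))" if "t \<in> {0..a}" for t
    proof (rule summable_comparison_test')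
      show "summable (\<lambda>k. norm (f t) * (?r ^ k / fact k))"
        by (intro summable_mult summ)
      show "norm (norm (?g k t)) \<le> norm (f t) * (?r ^ k / fact k)" for k
        using mult_left_mono[OF norm_le[OF that, of k], of "norm (f t)"]
        by (simp only: real_norm_def abs_mult abs_norm_cancel norm_mult norm_ge_zero)
    qed
    then show "AE t in ?M. summable (\<lambda>k. norm (?g k t))"
      by (intro AE_I2) (simp add: space_restrict_space)
    show "summable (\<lambda>k. LINT t|?M. norm (?g k t))"
    proof (rule summable_comparison_test')
      show "summable (\<lambda>k. (LINT t|?M. norm (f t)) * (?r ^ k / fact k))"
        by (intro summable_mult summ)
      fix k
      have "(LINT t|?M. norm (?g k t)) \<le> (LINT t|?M. norm (f t) * (?r ^ k / fact k))"
      proof (rule integral_mono)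
        fix t assume "t \<in> space ?M"
        then have "t \<in> {0..a}" by (simp add: space_restrict_space)
        then show "norm (?g k t) \<le> norm (f t) * (?r ^ k / fact k)"
          using mult_left_mono[OF norm_le, of t "norm (f t)" k]
          by (simp only: norm_mult norm_ge_zero)
      next
        show "integrable ?M (\<lambda>t. norm (?g k t))" using int by (rule integrable_norm)
        show "integrable ?M (\<lambda>t. norm (f t) * (?r ^ k / fact k))"
          using f by (intro integrable_mult_left integrable_norm) auto
      qed
      also have "\<dots> = (LINT t|?M. norm (f t)) * (?r ^ k / fact k)"
        by (rule integral_mult_left_zero)
      finally show "norm (LINT t|?M. norm (?g k t)) \<le> (LINT t|?M. norm (f t)) * (?r ^ k / fact k)"
        by simp
    qed
  qed
  moreover have "integral\<^sup>L ?M (?g k) = (LINT t|?M. f t * of_real t ^ k) / fact k * w ^ k" for k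
  proof -
    have "integral\<^sup>L ?M (?g k) = (LINT t|?M. (f t * of_real t ^ k) * (w ^ k / fact k))"
      by (simp add: mult_ac)
    also have "\<dots> = (LINT t|?M. f t * of_real t ^ k) * (w ^ k / fact k)"
      by (rule integral_mult_left_zero)
    finally show ?thesis by simp
  qed
  moreover have "(\<Sum>k. ?g k t) = f t * exp (w * of_real t)" for t
  proof -
    have "(\<lambda>k. of_real t ^ k * w ^ k / fact k) sums exp (w * of_real t)"
      using exp_converges[of "w * of_real t"]
      by (simp add: power_mult_distrib scaleR_conv_of_real divide_inverse mult_ac)
    then have "(\<lambda>k. ?g k t) sums (f t * exp (w * of_real t))"
      by (rule sums_mult)
    then show ?thesis by (rule sums_unique[symmetric])
  qed
  ultimately show ?thesis by (simp add: exp_transform_def)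
qed

lemma holomorphic_exp_transform:
  assumes "integrable (lebesgue_on {0..a}) f"
  shows "exp_transform a f holomorphic_on UNIV"
proof -
  have "exp_transform a f holomorphic_on ball 0 r" for r
    using exp_transform_sums[OF assms]
    by (intro power_series_holomorphic
          [where a = "\<lambda>k. (LINT t|lebesgue_on {0..a}. f t * of_real t ^ k) / fact k"]) simp
  then have "exp_transform a f field_differentiable at w" for w
    using holomorphic_on_imp_differentiable_at[of _ "ball 0 (norm w + 1)" w] by simp
  then show ?thesis
    by (simp add: holomorphic_on_def field_differentiable_at_within)
qed

text \<open>The Taylor coefficients of the transform at 0 are the moments of \<open>f\<close>
  divided by factorials, so all moments vanish.\<close>

lemma AE_eq_0_if_exp_transform_eq_0:
  assumes f: "integrable (lebesgue_on {0..a}) f" and zero: "\<And>w. exp_transform a f w = 0"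
  shows "AE t in lebesgue_on {0..a}. f t = 0"
proof (rule AE_eq_0_if_moments_eq_0[OF f])
  fix k
  let ?F = "Abs_fps (\<lambda>k. (LINT t|lebesgue_on {0..a}. f t * of_real t ^ k) / fact k)"
  have "exp_transform a f has_fps_expansion ?F"
    using exp_transform_sums[OF f] by (intro has_fps_expansionI) simp
  moreover have "exp_transform a f = (\<lambda>w. 0)" using zero by auto
  ultimately have "?F = 0"
    by (metis fps_expansion_unique_complex has_fps_expansion_0)
  then have "fps_nth ?F k = 0" by simp
  then show "(LINT t|lebesgue_on {0..a}. f t * of_real t ^ k) = 0" by simp
qed

lemma norm_exp_transform_le:
  assumes f: "integrable (lebesgue_on {0..a}) f"
  shows "norm (exp_transform a f w) \<le> (LINT t|lebesgue_on {0..a}. norm (f t)) * max 1 (exp (a * Re w))"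
proof -
  let ?M = "lebesgue_on {0..a}"
  have "norm (exp_transform a f w) \<le> (LINT t|?M. norm (f t * exp (w * of_real t)))"
    unfolding exp_transform_def by (rule integral_norm_bound)
  also have "\<dots> \<le> (LINT t|?M. norm (f t) * max 1 (exp (a * Re w)))"
  proof (rule integral_mono)
    show "integrable ?M (\<lambda>t. norm (f t * exp (w * of_real t)))"
      using integrable_exp_kernel[OF f] by (rule integrable_norm)
    show "integrable ?M (\<lambda>t. norm (f t) * max 1 (exp (a * Re w)))"
      using f by (intro integrable_mult_left integrable_norm) auto
    fix t assume "t \<in> space ?M"
    then have "t \<in> {0..a}" by (simp add: space_restrict_space)
    then show "norm (f t * exp (w * of_real t)) \<le> norm (f t) * max 1 (exp (a * Re w))"
      unfolding norm_mult by (intro mult_left_mono norm_exp_le_max) auto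
  qed
  finally show ?thesis by (simp only: integral_mult_left_zero)
qed

text \<open>Dominated convergence with majorant \<open>norm (f t)\<close>: for every
  \<open>t > 0\<close> the factor \<open>exp (- x * t)\<close> tends to 0.\<close>

lemma exp_transform_tendsto_0:
  assumes f: "integrable (lebesgue_on {0..a}) f"
  shows "((\<lambda>x::real. exp_transform a f (of_real (- x))) \<longlongrightarrow> 0) at_top"
proof -
  let ?M = "lebesgue_on {0..a}"
  have "((\<lambda>x::real. LINT t|?M. f t * exp (of_real (- x) * of_real t)) \<longlongrightarrow> (LINT t|?M. 0)) at_top"
  proof (rule integral_dominated_convergence_at_top[where w = "\<lambda>t. norm (f t)"])
    show "(\<lambda>t. f t * exp (of_real (- x) * of_real t)) \<in> borel_measurable ?M" for x
      using integrable_exp_kernel[OF f] by (rule borel_measurable_integrable)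
    show "integrable ?M (\<lambda>t. norm (f t))" using f by (rule integrable_norm)
    show "\<forall>\<^sub>F x in at_top. AE t in ?M. norm (f t * exp (of_real (- x) * of_real t)) \<le> norm (f t)"
    proof (rule eventually_mono[OF eventually_ge_at_top[of 0]], rule AE_I2)
      fix x t :: real assume "x \<ge> 0" "t \<in> space ?M"
      then have "- (x * t) \<le> 0" by (simp add: space_restrict_space)
      then show "norm (f t * exp (of_real (- x) * of_real t)) \<le> norm (f t)"
        by (simp add: norm_mult mult_left_le)
    qed
    \<comment> \<open>At \<open>t = 0\<close> the integrand stays equal to \<open>f 0\<close>, so
      this null set is removed.\<close>
    have "AE t in lebesgue. t \<noteq> 0"
      using AE_not_in[of "{0}" lebesgue] by (simp add: negligible_iff_null_sets[symmetric])
    then have "AE t in lebesgue. t \<in> {0..a} \<longrightarrow> ((\<lambda>x. f t * exp (of_real (- x) * of_real t)) \<longlongrightarrow> 0) at_top"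
    proof eventually_elim
      fix t :: real assume "t \<noteq> 0"
      show "t \<in> {0..a} \<longrightarrow> ((\<lambda>x. f t * exp (of_real (- x) * of_real t)) \<longlongrightarrow> 0) at_top"
      proof
        assume "t \<in> {0..a}"
        with \<open>t \<noteq> 0\<close> have "t > 0" by simp
        have "((\<lambda>x. exp (- x * t)) \<longlongrightarrow> 0) at_top"
          using \<open>t > 0\<close> by real_asymp
        then have "((\<lambda>x. f t * of_real (exp (- x * t))) \<longlongrightarrow> f t * of_real 0) at_top"
          by (intro tendsto_intros)
        then show "((\<lambda>x. f t * exp (of_real (- x) * of_real t)) \<longlongrightarrow> 0) at_top"
          by (simp flip: exp_of_real)
      qed
    qed
    then show "AE t in ?M. ((\<lambda>x. f t * exp (of_real (- x) * of_real t)) \<longlongrightarrow> 0) at_top"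
      by (simp add: AE_restrict_space_iff)
  qed auto
  then show ?thesis by (simp add: exp_transform_def)
qed

text \<open>The n-th power of a transform grows at most like \<open>exp (n * a * Re w)\<close> to
  the right. After rescaling by \<open>\<alpha>\<close> the exponent is
  \<open>n * a * \<alpha> * Re w\<close>, and \<open>dens\<close> brings this under the growth of
  \<open>exp w - 1\<close>.\<close>

lemma AE_proportional_if_transform_powers_eq_on_lattice:
  fixes f h :: "real \<Rightarrow> complex"
  assumes f: "integrable (lebesgue_on {0..a}) f" and h: "integrable (lebesgue_on {0..a}) h"
    and "n \<ge> 1" "\<alpha> > 0" "a > 0" and dens: "real n * a * \<alpha> \<le> 1"
    and eq: "\<And>k::int. exp_transform a f (2 * of_real pi * \<i> * of_real (\<alpha> * of_int k)) ^ n
                    = exp_transform a h (2 * of_real pi * \<i> * of_real (\<alpha> * of_int k)) ^ n"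
  obtains \<theta> where "\<theta> ^ n = 1" "AE t in lebesgue_on {0..a}. f t = \<theta> * h t"
proof -
  let ?F = "exp_transform a f" and ?H = "exp_transform a h"
  let ?N = "\<lambda>g. LINT t|lebesgue_on {0..a}. norm (g t)"
  \<comment> \<open>The factor \<open>\<alpha>\<close> moves the sampling points to the integer
    multiples of \<open>2 * pi * \<i>\<close>.\<close>
  define G where "G w = ?F (of_real \<alpha> * w) ^ n - ?H (of_real \<alpha> * w) ^ n" for w
  have hol: "(\<lambda>w. exp_transform a g (of_real \<alpha> * w)) holomorphic_on UNIV"
    if "integrable (lebesgue_on {0..a}) g" for g
    using holomorphic_on_compose_gen[of "\<lambda>w. of_real \<alpha> * w" UNIV "exp_transform a g" UNIV]
          holomorphic_exp_transform[OF that] by (auto simp: o_def intro: holomorphic_intros)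
  have bound: "norm (exp_transform a g (of_real \<alpha> * w) ^ n) \<le> ?N g ^ n * max 1 (exp (Re w))"
    if g: "integrable (lebesgue_on {0..a}) g" for g w
  proof -
    have "norm (exp_transform a g (of_real \<alpha> * w) ^ n) \<le> (?N g * max 1 (exp (a * (\<alpha> * Re w)))) ^ n"
      unfolding norm_power using norm_exp_transform_le[OF g, of "of_real \<alpha> * w"]
      by (intro power_mono) auto
    also have "\<dots> = ?N g ^ n * max 1 (exp (a * (\<alpha> * Re w))) ^ n"
      by (rule power_mult_distrib)
    \<comment> \<open>The density condition enters here, in the right half plane; in the left half
      plane both maxima are 1.\<close>
    also have "max 1 (exp (a * (\<alpha> * Re w))) ^ n \<le> max 1 (exp (Re w))"
    proof (cases "Re w \<ge> 0")
      case True
      then have "max 1 (exp (a * (\<alpha> * Re w))) ^ n = exp (real n * a * \<alpha> * Re w)"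
        using \<open>\<alpha> > 0\<close> \<open>a > 0\<close> by (simp add: exp_of_nat_mult[symmetric] max_absorb2 mult.assoc)
      also have "\<dots> \<le> exp (Re w)"
        using mult_right_mono[OF dens True] by simp
      finally show ?thesis by simp
    next
      case False
      then have "a * (\<alpha> * Re w) \<le> 0"
        using \<open>\<alpha> > 0\<close> \<open>a > 0\<close> by (simp add: mult_nonneg_nonpos)
      then show ?thesis by (simp add: max_absorb1)
    qed
    then have "?N g ^ n * max 1 (exp (a * (\<alpha> * Re w))) ^ n \<le> ?N g ^ n * max 1 (exp (Re w))"
      by (intro mult_left_mono zero_le_power integral_nonneg_AE) auto
    finally show ?thesis .
  qed
  have lim: "((\<lambda>x::real. exp_transform a g (of_real \<alpha> * of_real (- x))) \<longlongrightarrow> 0) at_top"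
    if "integrable (lebesgue_on {0..a}) g" for g
  proof -
    have "filterlim (\<lambda>x. \<alpha> * x) at_top at_top"
      using \<open>\<alpha> > 0\<close> by real_asymp
    from filterlim_compose[OF exp_transform_tendsto_0[OF that] this] show ?thesis by simp
  qed
  have "G w = 0" for w
  proof (rule entire_eq_zero_if_zero_on_periods[where G = G])
    show "G holomorphic_on UNIV"
      unfolding G_def by (intro holomorphic_intros hol f h)
    show "norm (G w) \<le> (?N f ^ n + ?N h ^ n) * max 1 (exp (Re w))" for w
      unfolding G_def distrib_right
      by (intro order_trans[OF norm_triangle_ineq4] add_mono bound f h)
    show "G (of_int k * (2 * of_real pi * \<i>)) = 0" for k :: int
      using eq[of k] by (simp add: G_def mult_ac)
    have "((\<lambda>x. G (of_real (- x))) \<longlongrightarrow> 0 ^ n - 0 ^ n) at_top"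
      unfolding G_def by (intro tendsto_intros lim f h)
    then show "((\<lambda>x. G (of_real (- x))) \<longlongrightarrow> 0) at_top" by simp
  qed
  \<comment> \<open>Every point has the form \<open>\<alpha> * v\<close> because
    \<open>\<alpha>\<close> is nonzero.\<close>
  then have "?F w ^ n = ?H w ^ n" for w
    using \<open>\<alpha> > 0\<close> by (metis G_def diff_eq_diff_eq diff_self nonzero_mult_div_cancel_left
        of_real_eq_0_iff order_less_irrefl right_minus_eq times_divide_eq_right)
  then obtain \<theta> where \<theta>: "\<theta> ^ n = 1" "\<And>w. ?F w = \<theta> * ?H w"
    using entire_functions_proportional_if_powers_eq[OF holomorphic_exp_transform[OF f]
            holomorphic_exp_transform[OF h] \<open>n \<ge> 1\<close>] by blast
  have "exp_transform a (\<lambda>t. f t - \<theta> * h t) w = 0" for w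
  proof -
    have "exp_transform a (\<lambda>t. f t - \<theta> * h t) w
        = (LINT t|lebesgue_on {0..a}. f t * exp (w * of_real t) - \<theta> * (h t * exp (w * of_real t)))"
      by (simp add: exp_transform_def algebra_simps)
    also have "\<dots> = ?F w - \<theta> * ?H w"
      using integrable_exp_kernel[OF f] integrable_exp_kernel[OF h]
      by (subst Bochner_Integration.integral_diff) (auto simp: exp_transform_def)
    finally show ?thesis using \<theta>(2) by simp
  qed
  then have "AE t in lebesgue_on {0..a}. f t - \<theta> * h t = 0"
    using f h by (intro AE_eq_0_if_exp_transform_eq_0) auto
  then show ?thesis using that \<theta>(1) by simp
qed

section \<open>Phase retrieval from exponentials\<close>

lemma finite_measure_lebesgue_on_Icc: "finite_measure (lebesgue_on {a..b::real})"
  by (metis cbox_interval finite_measure_lebesgue_on lmeasurable_cbox)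

text \<open>Expanding the square of \<open>norm (f x) - 1\<close> bounds \<open>norm (f x)\<close>
  by \<open>1 + (norm (f x))^2\<close>, and constants are integrable for a finite measure.\<close>

lemma L2_fun_integrable:
  assumes "finite_measure M" "f \<in> L2_fun M"
  shows "integrable M f"
proof (rule Bochner_Integration.integrable_bound)
  interpret finite_measure M by fact
  show "integrable M (\<lambda>x. 1 + (cmod (f x))\<^sup>2)" "f \<in> borel_measurable M"
    using assms(2) by (auto simp: L2_fun_def)
  have "2 * norm (f x) \<le> (norm (f x))\<^sup>2 + 1" for x
    using zero_le_power2[of "norm (f x) - 1"] by (simp add: power2_diff)
  then have "norm (f x) \<le> 1 + (norm (f x))\<^sup>2" for x
    by (smt (verit) norm_ge_zero)
  then show "AE x in M. norm (f x) \<le> norm (1 + (cmod (f x))\<^sup>2)"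
    by (intro AE_I2) (simp add: abs_of_nonneg)
qed

lemma cnj_exponential:
  "cnj (exponential (of_real \<nu>) t) = exp (2 * of_real pi * \<i> * of_real (- \<nu>) * of_real t)"
  by (simp add: exponential_def exp_cnj)

text \<open>Conjugating the exponential in the second argument reverses its frequency, hence the
  sign of \<open>\<nu>\<close>.\<close>

lemma L2_inner_exponential:
  assumes "f \<in> L2_fun (lebesgue_on {0..a})"
  shows "L2_inner (lebesgue_on {0..a}) (L2_class (lebesgue_on {0..a}) f)
           (L2_class (lebesgue_on {0..a}) (exponential (of_real \<nu>)))
         = exp_transform a f (2 * of_real pi * \<i> * of_real (- \<nu>))"
  by (simp only: L2_inner_class[OF assms exponential_in_L2_fun] cnj_exponential exp_transform_def)

section \<open>Translated indicators as a counterexample\<close>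

lemma indicator_in_L2_fun:
  fixes a :: real
  assumes "S \<in> sets lebesgue"
  shows "indicator S \<in> L2_fun (lebesgue_on {0..a})"
proof -
  let ?M = "lebesgue_on {0..a}"
  interpret finite_measure ?M
    by (rule finite_measure_lebesgue_on_Icc)
  have "(indicator S :: real \<Rightarrow> complex) \<in> borel_measurable ?M"
    using assms by (intro measurable_restrict_space1 borel_measurable_indicator) auto
  moreover have "(indicator S :: real \<Rightarrow> real) \<in> borel_measurable ?M"
    using assms by (intro measurable_restrict_space1 borel_measurable_indicator) auto
  then have "integrable ?M (indicator S :: real \<Rightarrow> real)"
    by (intro integrable_const_bound[where B = 1]) (auto simp: indicator_def)
  moreover have "(\<lambda>x. (cmod (indicator S x))\<^sup>2) = indicator S"
    by (auto simp: indicator_def)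
  ultimately show ?thesis by (simp add: L2_fun_def)
qed

text \<open>The substitution of \<open>s + t\<close> for \<open>t\<close> carries [0, a - s] onto
  [s, a] and splits the factor \<open>exp (w * s)\<close> off the kernel.\<close>

lemma exp_transform_indicator_shift:
  assumes "0 \<le> s"
  shows "exp_transform a (indicator {s..a}) w = exp (w * of_real s) * exp_transform a (indicator {0..a - s}) w"
proof -
  have "exp_transform a (indicator {s..a}) w
      = (LINT t|lebesgue. indicator {0..a} t *\<^sub>R (indicator {s..a} t * exp (w * of_real t)))"
    unfolding exp_transform_def by (subst integral_restrict_space) auto
  also have "\<dots> = (LINT t|lebesgue. indicator {0..a} (s + 1 * t) *\<^sub>R
                     (indicator {s..a} (s + 1 * t) * exp (w * of_real (s + 1 * t))))"
    by (subst lebesgue_integral_real_affine[of 1 _ s]) auto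
  \<comment> \<open>As \<open>0 \<le> s\<close>, both products of indicators equal the indicator of
    [0, a - s].\<close>
  also have "\<dots> = (LINT t|lebesgue. exp (w * of_real s) *
                     (indicator {0..a} t *\<^sub>R (indicator {0..a - s} t * exp (w * of_real t))))"
    using assms by (intro Bochner_Integration.integral_cong)
                   (auto simp: indicator_def distrib_left exp_add)
  also have "\<dots> = exp (w * of_real s) *
      (LINT t|lebesgue. indicator {0..a} t *\<^sub>R (indicator {0..a - s} t * exp (w * of_real t)))"
    by (rule integral_mult_right_zero)
  also have "(LINT t|lebesgue. indicator {0..a} t *\<^sub>R (indicator {0..a - s} t * exp (w * of_real t)))
      = exp_transform a (indicator {0..a - s}) w"
    unfolding exp_transform_def by (subst integral_restrict_space) auto
  finally show ?thesis .
qed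

text \<open>On the open interval from 0 to \<open>min s (a - s)\<close> the left indicator is 0 and
  the right one is 1, so equality at any of its points would force \<open>\<theta> = 0\<close>; this
  interval has positive measure.\<close>

lemma indicators_not_AE_proportional:
  fixes a s :: real and \<theta> :: complex
  assumes "0 < s" "s < a" "\<theta> \<noteq> 0"
  shows "\<not> (AE t in lebesgue_on {0..a}. indicator {s..a} t = \<theta> * indicator {0..a - s} t)"
proof
  let ?U = "{0<..<min s (a - s)}"
  assume "AE t in lebesgue_on {0..a}. indicator {s..a} t = \<theta> * indicator {0..a - s} t"
  then have "AE t in lebesgue. t \<in> {0..a} \<longrightarrow> indicator {s..a} t = \<theta> * indicator {0..a - s} t"
    by (simp add: AE_restrict_space_iff)
  then have "AE t in lebesgue. t \<notin> ?U"
  proof eventually_elim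
    fix t :: real
    assume "t \<in> {0..a} \<longrightarrow> indicator {s..a} t = \<theta> * indicator {0..a - s} t"
    then show "t \<notin> ?U" using assms by (auto simp: indicator_def)
  qed
  then have "negligible ?U"
    using AE_iff_null_sets[of ?U lebesgue] by (simp add: negligible_iff_null_sets)
  then show False
    using open_not_negligible[of ?U] assms by auto
qed

theorem theorem1p5:
  fixes a :: real and n :: nat and \<Lambda> :: "real set" and \<Theta> :: "complex set"
  assumes "a > 0"
    and "n \<ge> 1"
    and "is_lattice \<Lambda>"
    and "\<Theta> = {exp (2 * of_real pi * \<i> * of_nat k / of_nat n) | k. k \<in> {0..n - 1}}"
  shows "does_PR_L2 (lebesgue_on {0..a}) \<Theta> (L2_class (lebesgue_on {0..a}) ` exp_system \<Lambda>)
           \<longleftrightarrow> lattice_density \<Lambda> \<ge> real n * a"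
proof -
  let ?M = "lebesgue_on {0..a}"
  obtain \<alpha> where \<alpha>: "\<alpha> > 0" and \<Lambda>: "\<Lambda> = range (\<lambda>k::int. \<alpha> * of_int k)"
    using assms(3) by (auto simp: is_lattice_def)
  \<comment> \<open>As \<open>n \<ge> 1\<close>, the index range \<open>{0..n - 1}\<close> is the
    range of all \<open>k < n\<close>, so the phases are exactly the n-th roots of unity.\<close>
  have \<Theta>: "\<Theta> = {\<theta>. \<theta> ^ n = 1}"
    unfolding assms(4) complex_roots_unity[OF \<open>n \<ge> 1\<close>] using \<open>n \<ge> 1\<close> by force
  have \<Theta>_nz: "\<theta> \<noteq> 0" if "\<theta> \<in> \<Theta>" for \<theta>
    using that \<open>n \<ge> 1\<close> by (auto simp: \<Theta> power_0_left)
  have fin: "finite_measure ?M"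
    by (rule finite_measure_lebesgue_on_Icc)
  have dens: "lattice_density \<Lambda> \<ge> real n * a \<longleftrightarrow> real n * a * \<alpha> \<le> 1"
    using \<alpha> by (simp add: \<Lambda> lattice_density_eq pos_le_divide_eq)

  \<comment> \<open>Sufficiency of the density condition\<close>
  have "does_PR_L2 ?M \<Theta> (L2_class ?M ` exp_system \<Lambda>)" if le: "real n * a * \<alpha> \<le> 1"
    unfolding does_PR_L2_def does_PR_def
  proof (intro ballI impI)
    fix F H
    assume "F \<in> L2 ?M" "H \<in> L2 ?M"
      and meas: "\<forall>g\<in>L2_class ?M ` exp_system \<Lambda>. \<exists>\<theta>\<in>\<Theta>. L2_inner ?M F g = \<theta> * L2_inner ?M H g"
    then obtain f h where f: "f \<in> L2_fun ?M" "F = L2_class ?M f"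
      and h: "h \<in> L2_fun ?M" "H = L2_class ?M h"
      unfolding L2_def by (auto elim!: quotientE)
    have "exp_transform a f (2 * of_real pi * \<i> * of_real (\<alpha> * of_int k)) ^ n
        = exp_transform a h (2 * of_real pi * \<i> * of_real (\<alpha> * of_int k)) ^ n" for k
    proof -
      \<comment> \<open>The frequency is negated to offset the conjugation in the inner product; the
        lattice is symmetric, so this exponential belongs to the system.\<close>
      let ?e = "L2_class ?M (exponential (of_real (\<alpha> * of_int (- k))))"
      have "?e \<in> L2_class ?M ` exp_system \<Lambda>"
        unfolding exp_system_def \<Lambda> by blast
      then obtain \<theta> where \<theta>: "\<theta> \<in> \<Theta>" "L2_inner ?M F ?e = \<theta> * L2_inner ?M H ?e"
        using meas by blast
      then have "exp_transform a f (2 * of_real pi * \<i> * of_real (\<alpha> * of_int k))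
        = \<theta> * exp_transform a h (2 * of_real pi * \<i> * of_real (\<alpha> * of_int k))"
        unfolding f(2) h(2) L2_inner_exponential[OF f(1)] L2_inner_exponential[OF h(1)] by simp
      \<comment> \<open>The phase may depend on \<open>k\<close>; the n-th power removes it.\<close>
      then show ?thesis using \<theta>(1) by (simp add: power_mult_distrib \<Theta>)
    qed
    then obtain \<theta> where \<theta>: "\<theta> ^ n = 1" "AE t in ?M. f t = \<theta> * h t"
      using AE_proportional_if_transform_powers_eq_on_lattice[OF L2_fun_integrable[OF fin f(1)]
          L2_fun_integrable[OF fin h(1)] \<open>n \<ge> 1\<close> \<alpha> \<open>a > 0\<close> le] by blast
    have "F = L2_scale ?M \<theta> H"
      unfolding f(2) h(2) L2_scale_class[OF h(1)] L2_class_eq_iff[OF f(1) L2_fun_scale[OF h(1)]]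
      by (rule \<theta>(2))
    then show "\<exists>\<theta>\<in>\<Theta>. F = L2_scale ?M \<theta> H"
      using \<theta>(1) by (auto simp: \<Theta>)
  qed

  \<comment> \<open>Necessity of the density condition\<close>
  moreover have "\<not> does_PR_L2 ?M \<Theta> (L2_class ?M ` exp_system \<Lambda>)" if gt: "real n * a * \<alpha> > 1"
  proof
    assume PR: "does_PR_L2 ?M \<Theta> (L2_class ?M ` exp_system \<Lambda>)"
    \<comment> \<open>With this shift \<open>n * (\<alpha> * k * s)\<close> is the integer
      \<open>k\<close>, so translation by \<open>s\<close> multiplies each measurement by an n-th
      root of unity. The assumption \<open>gt\<close> is what makes \<open>s < a\<close>.\<close>
    define s where "s = 1 / (\<alpha> * real n)"
    have s: "0 < s" "s < a"
      using gt \<alpha> \<open>n \<ge> 1\<close> by (auto simp: s_def field_simps)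
    let ?f = "indicator {s..a} :: real \<Rightarrow> complex" and ?h = "indicator {0..a - s} :: real \<Rightarrow> complex"
    have f: "?f \<in> L2_fun ?M" and h: "?h \<in> L2_fun ?M"
      by (auto intro: indicator_in_L2_fun)
    have "\<exists>\<theta>\<in>\<Theta>. L2_inner ?M (L2_class ?M ?f) g = \<theta> * L2_inner ?M (L2_class ?M ?h) g"
      if "g \<in> L2_class ?M ` exp_system \<Lambda>" for g
    proof -
      from that obtain k :: int where g: "g = L2_class ?M (exponential (of_real (\<alpha> * of_int k)))"
        unfolding exp_system_def \<Lambda> by blast
      let ?w = "2 * of_real pi * \<i> * of_real (- (\<alpha> * of_int k))"
      have "of_nat n * (?w * of_real s) = 2 * of_real pi * \<i> * of_int (- k)"
        using \<alpha> \<open>n \<ge> 1\<close> by (simp add: s_def field_simps)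
      moreover have "exp (2 * of_real pi * \<i> * of_int (- k)) = 1"
        by (auto simp: exp_eq_1 intro!: exI[of _ "- k"])
      ultimately have "exp (?w * of_real s) ^ n = 1"
        by (metis exp_of_nat_mult)
      then have "exp (?w * of_real s) \<in> \<Theta>" by (simp add: \<Theta>)
      moreover have "L2_inner ?M (L2_class ?M ?f) g
          = exp (?w * of_real s) * L2_inner ?M (L2_class ?M ?h) g"
        unfolding g L2_inner_exponential[OF f] L2_inner_exponential[OF h]
        using s by (intro exp_transform_indicator_shift) simp
      ultimately show ?thesis by blast
    qed
    then obtain \<theta> where \<theta>: "\<theta> \<in> \<Theta>" "L2_class ?M ?f = L2_scale ?M \<theta> (L2_class ?M ?h)"
      using PR L2_class_in_L2[OF f] L2_class_in_L2[OF h]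
      unfolding does_PR_L2_def does_PR_def by blast
    then have "AE t in ?M. ?f t = \<theta> * ?h t"
      by (simp only: L2_scale_class[OF h] L2_class_eq_iff[OF f L2_fun_scale[OF h]])
    then show False
      using indicators_not_AE_proportional[OF s \<Theta>_nz[OF \<theta>(1)]] by blast
  qed
  ultimately show ?thesis
    unfolding dens by (meson not_le)
qed

end
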